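(* Let $N\ge 2$ and $d_0,\dots,d_N,p_1,\dots,p_N,q_0,\dots,q_N\ge 1$ be integers, $d=\sum_{i=0}^N d_i$, $p=\sum_{i=1}^N p_i$. Let $\mathcal{X}_i\subset\mathbb{R}^{d_i}$ ($0\le i\le N$), $\mathcal{X}=\prod_{i=0}^N\mathcal{X}_i$, $\mathcal{Y}_i\subset\mathbb{R}^{p_i}$ ($1\le i\le N$), and $\mathcal{Y}=\prod_{i=1}^N\mathcal{Y}_i\subset\mathbb{R}^p$, and assume $\mathcal{Y}$ is convex and compact. Write $\mathbf{x}=(\mathbf{x}_0,\dots,\mathbf{x}_N)$, $\mathbf{y}=(\mathbf{y}_1,\dots,\mathbf{y}_N)$, $\mathbf{y}_{-i}=(\mathbf{y}_j)_{j\ne i}$, $\mathcal{Y}_{-i}=\prod_{j\ne i}\mathcal{Y}_j$. Let $f:\mathcal{X}\to\mathbb{R}$, $g_0:\mathcal{X}\to\mathbb{R}^{q_0}$, $g_i:\mathcal{X}_0\times\mathcal{X}_i\to\mathbb{R}^{q_i}$, and $g(\mathbf{x})=(g_0(\mathbf{x}),g_1(\mathbf{x}_0,\mathbf{x}_1),\dots,g_N(\mathbf{x}_0,\mathbf{x}_N))$. Let $h_i:\mathcal{X}_0\times\mathcal{X}_i\times\mathcal{Y}_{-i}\to\mathcal{Y}_i$ ($1\le i\le N$) and $h(\mathbf{x},\mathbf{y})=(h_i(\mathbf{x}_0,\mathbf{x}_i,\mathbf{y}_{-i}))_i\in\mathcal{Y}$, and assume that for every $\mathbf{x}\in\mathcal{X}$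 the map $\mathbf{y}\mapsto h(\mathbf{x},\mathbf{y})$ is continuous on $\mathcal{Y}$. Let $\mathcal{S}=\{(\mathbf{x},\mathbf{y})\in\mathcal{X}\times\mathcal{Y}:\mathbf{y}=h(\mathbf{x},\mathbf{y})\}$. Let $L:\mathcal{X}\times\mathcal{Y}\to\mathbb{R}^d$ satisfy $L(\mathbf{x},\mathbf{y})=\mathbf{x}$ for all $(\mathbf{x},\mathbf{y})\in\mathcal{S}$, with $\tilde f=f\circ L$, $\tilde g=g\circ L$ defined on $\mathcal{X}\times\mathcal{Y}$. Consider (P): minimize $f(\mathbf{x})$ subject to $g_0(\mathbf{x})\le0$, $g_i(\mathbf{x}_0,\mathbf{x}_i)\le 0$ ($1\le i\le N$); and (MDO): minimize $\tilde f(\mathbf{x},\mathbf{y})$ over $(\mathbf{x},\mathbf{y})\in\mathcal{X}\times\mathcal{Y}$ subject to $\tilde g(\mathbf{x},\mathbf{y})\le 0$ and $\mathbf{y}_i=h_i(\mathbf{x}_0,\mathbf{x}_i,\mathbf{y}_{-i})$ ($1\le i\le N$). Then solving (MDO) on $\mathcal{X}\times\mathcal{Y}$ is equivalent to solving (P) on $\mathcal{X}$: a pair $(\mathbf{x},\mathbf{y})\in\mathcal{X}\times\mathcal{Y}$ is a solution of (MDO) if and only if $(\mathbf{x},\mathbf{y})\in\mathcal{S}$ and $\mathbf{x}$ is a solution of (P) over $\mathcal{X}$. Furthermore, these solutions do not depend on $L$.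
   Context: "Solution" means a global minimizer among feasible points; inequalities are componentwise. *)

theory Defs
  imports "HOL-Analysis.Analysis"
begin

text \<open>Vectors of R^n are represented as functions nat => real vanishing from index n on.
  Block vectors (x_0,...,x_N) are functions nat => (nat => real); blocks outside the
  index set are the zero vector.  The topology is the (product) topology of functions,
  which on these finite-dimensional carriers is the Euclidean one.\<close>

definition Rn :: "nat \<Rightarrow> (nat \<Rightarrow> real) set" where
  "Rn n = {v. \<forall>j\<ge>n. v j = 0}"

definition zvec :: "nat \<Rightarrow> real" where
  "zvec = (\<lambda>_. 0)"

definition blockprod :: "nat set \<Rightarrow> (nat \<Rightarrow> (nat \<Rightarrow> real) set) \<Rightarrow> (nat \<Rightarrow> nat \<Rightarrow> real) set" where
  "blockprod I A = {z. (\<forall>i\<in>I. z i \<in> A i) \<and> (\<forall>i. i \<notin> I \<longrightarrow> z i = zvec)}"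

definition convex_blocks :: "(nat \<Rightarrow> nat \<Rightarrow> real) set \<Rightarrow> bool" where
  "convex_blocks Y \<longleftrightarrow> (\<forall>y\<in>Y. \<forall>y'\<in>Y. \<forall>t::real. 0 \<le> t \<and> t \<le> 1 \<longrightarrow>
      (\<lambda>i j. (1 - t) * y i j + t * y' i j) \<in> Y)"

definition nonpos :: "nat \<Rightarrow> (nat \<Rightarrow> real) \<Rightarrow> bool" where
  "nonpos q v \<longleftrightarrow> (\<forall>j<q. v j \<le> 0)"

definition feasP :: "nat \<Rightarrow> (nat \<Rightarrow> nat) \<Rightarrow> ((nat \<Rightarrow> nat \<Rightarrow> real) \<Rightarrow> (nat \<Rightarrow> real))
    \<Rightarrow> (nat \<Rightarrow> (nat \<Rightarrow> real) \<Rightarrow> (nat \<Rightarrow> real) \<Rightarrow> (nat \<Rightarrow> real)) \<Rightarrow> (nat \<Rightarrow> nat \<Rightarrow> real) \<Rightarrow> bool" where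
  "feasP N q g0 g x \<longleftrightarrow> nonpos (q 0) (g0 x) \<and> (\<forall>i\<in>{1..N}. nonpos (q i) (g i (x 0) (x i)))"

definition solves_P where
  "solves_P N q f g0 g X x \<longleftrightarrow> x \<in> X \<and> feasP N q g0 g x \<and>
     (\<forall>x'\<in>X. feasP N q g0 g x' \<longrightarrow> f x \<le> f x')"

text \<open>y_{-i} is represented as y with the i-th block replaced by zero.\<close>
definition ymin :: "(nat \<Rightarrow> nat \<Rightarrow> real) \<Rightarrow> nat \<Rightarrow> (nat \<Rightarrow> nat \<Rightarrow> real)" where
  "ymin y i = y(i := zvec)"

definition hmap :: "nat \<Rightarrow> (nat \<Rightarrow> (nat \<Rightarrow> real) \<Rightarrow> (nat \<Rightarrow> real) \<Rightarrow> (nat \<Rightarrow> nat \<Rightarrow> real) \<Rightarrow> (nat \<Rightarrow> real))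
    \<Rightarrow> (nat \<Rightarrow> nat \<Rightarrow> real) \<Rightarrow> (nat \<Rightarrow> nat \<Rightarrow> real) \<Rightarrow> (nat \<Rightarrow> nat \<Rightarrow> real)" where
  "hmap N h x y = (\<lambda>i. if i \<in> {1..N} then h i (x 0) (x i) (ymin y i) else zvec)"

definition feasMDO where
  "feasMDO N q g0 g h L X Y x y \<longleftrightarrow> x \<in> X \<and> y \<in> Y \<and> feasP N q g0 g (L x y) \<and>
     (\<forall>i\<in>{1..N}. y i = h i (x 0) (x i) (ymin y i))"

definition solves_MDO where
  "solves_MDO N q f g0 g h L X Y x y \<longleftrightarrow> feasMDO N q g0 g h L X Y x y \<and>
     (\<forall>x' y'. feasMDO N q g0 g h L X Y x' y' \<longrightarrow> f (L x y) \<le> f (L x' y'))"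

end

theory Submission
  imports Defs "HOL-Homology.Homology"
begin

(* For fixed x, the coupling equations y_i = h_i(x_0, x_i, y_{-i}) say that y is a fixed
   point of the continuous self-map y \<mapsto> h(x, y) of the compact convex set Y, so by
   Brouwer's theorem every x in X extends to a point (x, y) of S.  On S the surrogates
   f \<circ> L and g \<circ> L agree with f and g, and (MDO)-feasibility of (x, y) amounts to
   (x, y) \<in> S together with (P)-feasibility of x; hence minimisers correspond, whatever L
   is off S.

   Vectors are finitely supported functions nat \<Rightarrow> real of variable dimension, so the
   library's Brouwer theorem (for types of class euclidean_space) does not apply.  It is
   re-derived: for the unit ball from the non-contractibility of the sphere, for compact
   convex sets via the nearest-point retraction, and for block vectors by flattening. *)

section \<open>Nearest points in compact convex sets\<close>

definition sqdist :: "nat \<Rightarrow> (nat \<Rightarrow> real) \<Rightarrow> (nat \<Rightarrow> real) \<Rightarrow> real" where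
  "sqdist n x y = (\<Sum>i<n. (x i - y i)\<^sup>2)"

definition convex_fun :: "(nat \<Rightarrow> real) set \<Rightarrow> bool" where
  "convex_fun K \<longleftrightarrow> (\<forall>x\<in>K. \<forall>y\<in>K. \<forall>t::real. 0 \<le> t \<and> t \<le> 1 \<longrightarrow> (\<lambda>i. (1 - t) * x i + t * y i) \<in> K)"

definition is_closest :: "nat \<Rightarrow> (nat \<Rightarrow> real) set \<Rightarrow> (nat \<Rightarrow> real) \<Rightarrow> (nat \<Rightarrow> real) \<Rightarrow> bool" where
  "is_closest n K z p \<longleftrightarrow> p \<in> K \<and> (\<forall>k\<in>K. sqdist n z p \<le> sqdist n z k)"

definition closest_pt :: "nat \<Rightarrow> (nat \<Rightarrow> real) set \<Rightarrow> (nat \<Rightarrow> real) \<Rightarrow> (nat \<Rightarrow> real)" where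
  "closest_pt n K z = (SOME p. is_closest n K z p)"

lemma sqdist_nonneg: "0 \<le> sqdist n x y"
  by (simp add: sqdist_def sum_nonneg)

lemma sqdist_self [simp]: "sqdist n x x = 0"
  by (simp add: sqdist_def)

lemma sqdist_eq_0_iff: "sqdist n x y = 0 \<longleftrightarrow> (\<forall>i<n. x i = y i)"
  by (auto simp: sqdist_def sum_nonneg_eq_0_iff)

lemma sqdist_eq_0_imp_eq:
  assumes "sqdist n x y = 0" "x \<in> Rn n" "y \<in> Rn n"
  shows "x = y"
proof
  fix i show "x i = y i"
    using assms by (cases "i < n") (auto simp: sqdist_eq_0_iff Rn_def)
qed

lemma continuous_on_sqdist [continuous_intros]:
  assumes "\<And>i. continuous_on S (\<lambda>s. f s i)" "\<And>i. continuous_on S (\<lambda>s. g s i)"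
  shows "continuous_on S (\<lambda>s. sqdist n (f s) (g s))"
  unfolding sqdist_def by (intro continuous_intros assms)

lemma closest_variational_ineq:
  assumes "convex_fun K" "is_closest n K z p" "k \<in> K"
  shows "(\<Sum>i<n. (z i - p i) * (k i - p i)) \<le> 0"
proof (rule ccontr)
  define a where "a = (\<Sum>i<n. (z i - p i) * (k i - p i))"
  define b where "b = sqdist n k p"
  assume "\<not> (\<Sum>i<n. (z i - p i) * (k i - p i)) \<le> 0"
  then have a_pos: "a > 0" by (simp add: a_def)
  have step: "2 * t * a \<le> t\<^sup>2 * b" if "0 \<le> t" "t \<le> 1" for t
  proof -
    have "(\<lambda>i. (1 - t) * p i + t * k i) \<in> K"
      using assms that unfolding convex_fun_def is_closest_def by blast
    then have "sqdist n z p \<le> sqdist n z (\<lambda>i. (1 - t) * p i + t * k i)"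
      using assms(2) by (simp add: is_closest_def)
    also have "\<dots> = sqdist n z p - 2 * t * a + t\<^sup>2 * b"
      unfolding sqdist_def a_def b_def sum_distrib_left sum_subtractf[symmetric] sum.distrib[symmetric]
      by (rule sum.cong) (auto simp: power2_eq_square algebra_simps)
    finally show ?thesis by simp
  qed
  show False
  proof (cases "b = 0")
    case True
    then show False using step[of 1] a_pos by simp
  next
    case False
    then have b_pos: "b > 0" using sqdist_nonneg[of n k p] by (simp add: b_def)
    define t where "t = min 1 (a / b)"
    have t: "0 < t" "t \<le> 1" "t * b \<le> a"
      using a_pos b_pos by (auto simp: t_def min_def field_simps)
    have "2 * t * a \<le> t * (t * b)" using step[of t] t by (simp add: power2_eq_square)
    then have "2 * a \<le> t * b" using t by simp
    then show False using t a_pos by linarith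
  qed
qed

lemma closest_nonexpansive:
  assumes K: "convex_fun K" and p: "is_closest n K z p" and q: "is_closest n K y q"
  shows "sqdist n p q \<le> sqdist n z y"
proof -
  have "(\<Sum>i<n. (z i - p i) * (q i - p i)) \<le> 0" "(\<Sum>i<n. (y i - q i) * (p i - q i)) \<le> 0"
    using closest_variational_ineq[OF K p] closest_variational_ineq[OF K q] p q
    by (auto simp: is_closest_def)
  moreover have "(\<Sum>i<n. (z i - p i) * (q i - p i)) + (\<Sum>i<n. (y i - q i) * (p i - q i))
      = sqdist n p q - (\<Sum>i<n. (z i - y i) * (p i - q i))"
    unfolding sqdist_def sum.distrib[symmetric] sum_subtractf[symmetric]
    by (rule sum.cong) (auto simp: power2_eq_square algebra_simps)
  moreover have "0 \<le> sqdist n (\<lambda>i. z i - y i) (\<lambda>i. p i - q i)"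
    by (rule sqdist_nonneg)
  moreover have "sqdist n (\<lambda>i. z i - y i) (\<lambda>i. p i - q i)
      = sqdist n z y - 2 * (\<Sum>i<n. (z i - y i) * (p i - q i)) + sqdist n p q"
    unfolding sqdist_def sum_distrib_left sum.distrib[symmetric] sum_subtractf[symmetric]
    by (rule sum.cong) (auto simp: power2_eq_square algebra_simps)
  ultimately show ?thesis by linarith
qed

lemma closest_exists:
  assumes "compact K" "K \<noteq> {}"
  shows "\<exists>p. is_closest n K z p"
proof -
  have "continuous_on K (sqdist n z)"
    by (intro continuous_intros continuous_on_product_then_coordinatewise continuous_on_id)
  then show ?thesis
    using continuous_attains_inf[OF assms] unfolding is_closest_def by blast
qed

lemma
  assumes "compact K" "K \<noteq> {}"
  shows closest_pt_is_closest: "is_closest n K z (closest_pt n K z)"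
    and closest_pt_in: "closest_pt n K z \<in> K"
  using someI_ex[OF closest_exists[OF assms]] by (simp_all add: closest_pt_def is_closest_def)

lemma closest_pt_id:
  assumes "compact K" "K \<subseteq> Rn n" "z \<in> K"
  shows "closest_pt n K z = z"
proof -
  have ne: "K \<noteq> {}" using assms(3) by blast
  have "sqdist n z (closest_pt n K z) = 0"
    using closest_pt_is_closest[OF assms(1) ne, of n z] assms(3)
      sqdist_nonneg[of n z "closest_pt n K z"]
    unfolding is_closest_def by (metis order_antisym sqdist_self)
  then show ?thesis
    using closest_pt_in[OF assms(1) ne, of n z] assms by (auto intro: sqdist_eq_0_imp_eq[symmetric])
qed

lemma continuous_closest_pt:
  assumes K: "compact K" "K \<noteq> {}" "convex_fun K" "K \<subseteq> Rn n"
  shows "continuous_on UNIV (closest_pt n K)"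
proof (intro continuous_on_coordinatewise_then_product)
  fix i
  show "continuous_on UNIV (\<lambda>z. closest_pt n K z i)"
  proof (cases "i < n")
    case False
    then have "(\<lambda>z. closest_pt n K z i) = (\<lambda>z. 0)"
      using closest_pt_in[OF K(1,2), of n] K(4) False by (intro ext) (auto simp: Rn_def subset_iff)
    then show ?thesis by (metis continuous_on_const)
  next
    case True
    have "\<bar>closest_pt n K z i - closest_pt n K z0 i\<bar> \<le> sqrt (sqdist n z z0)" for z z0
    proof -
      have "(closest_pt n K z i - closest_pt n K z0 i)\<^sup>2 \<le> sqdist n (closest_pt n K z) (closest_pt n K z0)"
        unfolding sqdist_def using True by (intro member_le_sum) auto
      also have "\<dots> \<le> sqdist n z z0"
        using closest_nonexpansive[OF K(3) closest_pt_is_closest closest_pt_is_closest] K by blast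
      finally show ?thesis using real_sqrt_le_mono by fastforce
    qed
    moreover have "((\<lambda>z. sqrt (sqdist n z z0)) \<longlongrightarrow> 0) (at z0)" for z0
    proof -
      have "continuous_on UNIV (\<lambda>z. sqrt (sqdist n z z0))"
        by (intro continuous_intros continuous_on_product_then_coordinatewise continuous_on_id)
      then show ?thesis
        by (metis UNIV_I continuous_on_def real_sqrt_zero sqdist_self)
    qed
    ultimately show ?thesis
      unfolding continuous_on_def
      by (metis (no_types, lifting) LIM_zero_cancel Lim_null_comparison always_eventually real_norm_def)
  qed
qed

section \<open>Brouwer's fixed point theorem in coordinates\<close>

definition sqnorm :: "nat \<Rightarrow> (nat \<Rightarrow> real) \<Rightarrow> real" where
  "sqnorm n x = (\<Sum>i<n. (x i)\<^sup>2)"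

definition unit_ball :: "nat \<Rightarrow> (nat \<Rightarrow> real) set" where
  "unit_ball n = {x \<in> Rn n. sqnorm n x \<le> 1}"

definition unit_sphere :: "nat \<Rightarrow> (nat \<Rightarrow> real) set" where
  "unit_sphere n = {x \<in> Rn n. sqnorm n x = 1}"

definition normalize_vec :: "nat \<Rightarrow> (nat \<Rightarrow> real) \<Rightarrow> (nat \<Rightarrow> real)" where
  "normalize_vec n v = (\<lambda>i. v i / sqrt (sqnorm n v))"

lemma sqnorm_nonneg: "0 \<le> sqnorm n x"
  by (simp add: sqnorm_def sum_nonneg)

lemma sqnorm_eq_0_iff: "sqnorm n x = 0 \<longleftrightarrow> (\<forall>i<n. x i = 0)"
  by (auto simp: sqnorm_def sum_nonneg_eq_0_iff)

lemma continuous_on_sqnorm [continuous_intros]: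
  assumes "\<And>i. continuous_on S (\<lambda>s. f s i)"
  shows "continuous_on S (\<lambda>s. sqnorm n (f s))"
  unfolding sqnorm_def by (intro continuous_intros assms)

lemma sqnorm_normalize_vec:
  assumes "sqnorm n v \<noteq> 0"
  shows "sqnorm n (normalize_vec n v) = 1"
proof -
  have "sqnorm n (normalize_vec n v) = sqnorm n v / (sqrt (sqnorm n v))\<^sup>2"
    by (simp add: sqnorm_def normalize_vec_def power_divide sum_divide_distrib)
  then show ?thesis
    using assms sqnorm_nonneg[of n v] by simp
qed

lemma normalize_vec_in_unit_sphere:
  assumes "v \<in> Rn n" "sqnorm n v \<noteq> 0"
  shows "normalize_vec n v \<in> unit_sphere n"
  using assms sqnorm_normalize_vec[OF assms(2)] by (simp add: unit_sphere_def normalize_vec_def Rn_def)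

lemma normalize_vec_unit_sphere [simp]: "x \<in> unit_sphere n \<Longrightarrow> normalize_vec n x = x"
  by (simp add: unit_sphere_def normalize_vec_def)

lemma continuous_on_normalize_vec:
  assumes "\<And>i. continuous_on S (\<lambda>s. f s i)" "\<And>s. s \<in> S \<Longrightarrow> sqnorm n (f s) \<noteq> 0"
  shows "continuous_on S (\<lambda>s. normalize_vec n (f s))"
  unfolding normalize_vec_def
  using assms sqnorm_nonneg by (intro continuous_intros assms) fastforce

lemma unit_sphere_subset_ball: "unit_sphere n \<subseteq> unit_ball n"
  by (auto simp: unit_sphere_def unit_ball_def)

lemma nsphere_eq_unit_sphere: "nsphere m = top_of_set (unit_sphere (Suc m))"
proof -
  have "{x. (\<Sum>i\<le>m. x i ^ 2) = 1 \<and> (\<forall>i>m. x i = 0)} = unit_sphere (Suc m)"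
    by (auto simp: unit_sphere_def sqnorm_def Rn_def lessThan_Suc_atMost Suc_le_eq)
  then show ?thesis
    by (simp add: nsphere euclidean_product_topology)
qed

lemma two_sum_mult_le_sqnorm_add: "2 * (\<Sum>i<n. x i * y i) \<le> sqnorm n x + sqnorm n y"
proof -
  have "0 \<le> sqdist n x y"
    by (rule sqdist_nonneg)
  also have "\<dots> = sqnorm n x + sqnorm n y - 2 * (\<Sum>i<n. x i * y i)"
    unfolding sqdist_def sqnorm_def sum_distrib_left sum.distrib[symmetric] sum_subtractf[symmetric]
    by (rule sum.cong) (auto simp: power2_eq_square algebra_simps)
  finally show ?thesis by simp
qed

lemma sum_normalize_diff_mult_nonneg:
  assumes "x \<in> unit_sphere n" "y \<in> unit_ball n"
  shows "0 \<le> (\<Sum>i<n. normalize_vec n (\<lambda>i. x i - y i) i * x i)"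
proof -
  have "2 * (\<Sum>i<n. y i * x i) \<le> sqnorm n y + sqnorm n x"
    by (rule two_sum_mult_le_sqnorm_add)
  then have "0 \<le> (\<Sum>i<n. (x i - y i) * x i)"
    using assms by (simp add: unit_sphere_def unit_ball_def sqnorm_def left_diff_distrib
        sum_subtractf power2_eq_square)
  then show ?thesis
    using sqnorm_nonneg[of n "\<lambda>i. x i - y i"]
    by (simp add: normalize_vec_def sum_divide_distrib[symmetric] zero_le_divide_iff)
qed

lemma homotopic_with_canon_intro:
  assumes "continuous_on ({0..1::real} \<times> S) H" "H \<in> {0..1} \<times> S \<rightarrow> T"
    and "\<And>x. x \<in> S \<Longrightarrow> H (0, x) = f x" "\<And>x. x \<in> S \<Longrightarrow> H (1, x) = g x"
  shows "homotopic_with_canon (\<lambda>_. True) S T f g"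
  by (simp add: homotopic_with) (rule exI[of _ H], simp add: assms)

lemma continuous_on_snd_coordinate:
  "continuous_on S (\<lambda>p :: 'a::topological_space \<times> (nat \<Rightarrow> real). snd p i)"
  by (rule continuous_on_product_then_coordinatewise[OF continuous_on_snd[OF continuous_on_id]])

lemma contractible_unit_ball: "contractible (unit_ball n)"
  unfolding contractible_def
proof (intro exI homotopic_with_canon_intro)
  let ?H = "\<lambda>p :: real \<times> (nat \<Rightarrow> real). (\<lambda>i. (1 - fst p) * snd p i)"
  show "continuous_on ({0..1} \<times> unit_ball n) ?H"
    by (intro continuous_on_coordinatewise_then_product continuous_on_mult continuous_on_diff
        continuous_on_const continuous_on_fst[OF continuous_on_id] continuous_on_snd_coordinate)
  show "?H \<in> {0..1} \<times> unit_ball n \<rightarrow> unit_ball n"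
  proof safe
    fix t :: real and x assume t: "t \<in> {0..1}" and x: "x \<in> unit_ball n"
    have "sqnorm n (\<lambda>i. (1 - t) * x i) = (1 - t)\<^sup>2 * sqnorm n x"
      by (simp add: sqnorm_def power_mult_distrib sum_distrib_left)
    also have "\<dots> \<le> 1"
      using t x by (intro mult_le_one) (auto simp: unit_ball_def power_le_one sqnorm_nonneg)
    finally show "?H (t, x) \<in> unit_ball n"
      using x by (simp add: unit_ball_def Rn_def)
  qed
  show "?H (0, x) = id x" for x by simp
  show "?H (1, x) = zvec" for x by (simp add: zvec_def)
qed

lemma sqnorm_nonzero_if_inner_nonzero:
  assumes "(\<Sum>i<n. v i * x i) \<noteq> 0"
  shows "sqnorm n v \<noteq> 0"
proof
  assume "sqnorm n v = 0"
  then have "\<forall>i\<in>{..<n}. v i * x i = 0" by (simp add: sqnorm_eq_0_iff)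
  with assms show False by (simp add: sum.neutral)
qed

lemma homotopic_id_if_nonantipodal:
  assumes g: "continuous_on (unit_sphere n) g" "g \<in> unit_sphere n \<rightarrow> unit_sphere n"
    and nonantipodal: "\<And>x. x \<in> unit_sphere n \<Longrightarrow> 0 \<le> (\<Sum>i<n. g x i * x i)"
  shows "homotopic_with_canon (\<lambda>_. True) (unit_sphere n) (unit_sphere n) id g"
proof (rule homotopic_with_canon_intro)
  define v where "v p = (\<lambda>i. (1 - fst p) * snd p i + fst p * g (snd p) i)"
    for p :: "real \<times> (nat \<Rightarrow> real)"
  have v_nonzero: "sqnorm n (v p) \<noteq> 0" if p_in: "p \<in> {0..1} \<times> unit_sphere n" for p
  proof -
    obtain t x where p: "p = (t, x)" and t: "0 \<le> t" "t \<le> 1" and x: "x \<in> unit_sphere n"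
      using p_in by (cases p) auto
    show ?thesis
    proof (cases "t = 1")
      case True
      have "g x \<in> unit_sphere n" using g(2) x by auto
      then show ?thesis using True by (simp add: p v_def unit_sphere_def)
    next
      case False
      have "(\<Sum>i<n. v p i * x i) = (1 - t) * sqnorm n x + t * (\<Sum>i<n. g x i * x i)"
        unfolding sqnorm_def sum_distrib_left sum.distrib[symmetric]
        by (rule sum.cong) (auto simp: p v_def algebra_simps power2_eq_square)
      also have "\<dots> > 0"
        using t False x nonantipodal[OF x] by (simp add: unit_sphere_def add_pos_nonneg)
      finally show ?thesis
        using sqnorm_nonzero_if_inner_nonzero[where n = n and v = "v p" and x = x] by linarith
    qed
  qed
  have cont_v: "continuous_on ({0..1} \<times> unit_sphere n) (\<lambda>p. v p i)" for i
  proof -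
    have g_i: "continuous_on ({0..1::real} \<times> unit_sphere n) (\<lambda>p. g (snd p) i)"
      by (rule continuous_on_compose2[OF continuous_on_product_then_coordinatewise[OF g(1)]
            continuous_on_snd[OF continuous_on_id]]) force
    show ?thesis
      unfolding v_def
      by (intro continuous_on_add continuous_on_mult continuous_on_diff continuous_on_const
          continuous_on_fst[OF continuous_on_id] continuous_on_snd_coordinate g_i)
  qed
  show "continuous_on ({0..1} \<times> unit_sphere n) (\<lambda>p. normalize_vec n (v p))"
    by (rule continuous_on_normalize_vec[OF cont_v v_nonzero])
  show "(\<lambda>p. normalize_vec n (v p)) \<in> {0..1} \<times> unit_sphere n \<rightarrow> unit_sphere n"
  proof
    fix p :: "real \<times> (nat \<Rightarrow> real)"
    assume p: "p \<in> {0..1} \<times> unit_sphere n"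
    then have "snd p \<in> Rn n" "g (snd p) \<in> Rn n"
      using g(2) by (auto simp: unit_sphere_def)
    then have "v p \<in> Rn n" by (simp add: v_def Rn_def)
    then show "normalize_vec n (v p) \<in> unit_sphere n"
      using normalize_vec_in_unit_sphere v_nonzero[OF p] by blast
  qed
  show "normalize_vec n (v (0, x)) = id x" if "x \<in> unit_sphere n" for x
    using that by (simp add: v_def)
  show "normalize_vec n (v (1, x)) = g x" if "x \<in> unit_sphere n" for x
    using that g(2) by (simp add: v_def Pi_iff)
qed

lemma no_nonantipodal_map_ball_to_sphere:
  assumes g: "continuous_on (unit_ball (Suc m)) g" "g \<in> unit_ball (Suc m) \<rightarrow> unit_sphere (Suc m)"
    and nonantipodal: "\<And>x. x \<in> unit_sphere (Suc m) \<Longrightarrow> 0 \<le> (\<Sum>i<Suc m. g x i * x i)"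
  shows False
proof -
  let ?S = "unit_sphere (Suc m)" and ?B = "unit_ball (Suc m)"
  have g_S: "continuous_on ?S g" "g \<in> ?S \<rightarrow> ?S"
    using g unit_sphere_subset_ball by (auto intro: continuous_on_subset)
  have "(\<lambda>x. x) \<in> ?S \<rightarrow> ?B"
    using unit_sphere_subset_ball by auto
  then obtain c where "homotopic_with_canon (\<lambda>_. True) ?S ?S (g \<circ> (\<lambda>x. x)) (\<lambda>_. c)"
    by (rule nullhomotopic_through_contractible[OF continuous_on_id _ g contractible_unit_ball])
  then have "homotopic_with_canon (\<lambda>_. True) ?S ?S id (\<lambda>_. c)"
    using homotopic_with_trans[OF homotopic_id_if_nonantipodal[OF g_S nonantipodal]]
    by (simp add: comp_def)
  then have "contractible ?S"
    by (auto simp: contractible_def)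
  then show False
    using non_contractible_space_nsphere[of m] by (simp add: nsphere_eq_unit_sphere)
qed

theorem brouwer_unit_ball:
  assumes f: "continuous_on (unit_ball n) f" "f \<in> unit_ball n \<rightarrow> unit_ball n"
  shows "\<exists>x\<in>unit_ball n. f x = x"
proof (cases n)
  case 0
  then have "unit_ball n = {zvec}"
    by (auto simp: unit_ball_def Rn_def sqnorm_def zvec_def)
  then show ?thesis using f(2) by auto
next
  case (Suc m)
  show ?thesis
  proof (rule ccontr)
    assume no_fixpoint: "\<not> ?thesis"
    define w where "w x = (\<lambda>i. x i - f x i)" for x
    have w_nonzero: "sqnorm n (w x) \<noteq> 0" if x: "x \<in> unit_ball n" for x
    proof
      assume "sqnorm n (w x) = 0"
      then have "sqdist n x (f x) = 0"
        by (simp add: w_def sqdist_def sqnorm_def)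
      then have "x = f x"
        using x f(2) by (intro sqdist_eq_0_imp_eq) (auto simp: unit_ball_def)
      then show False using no_fixpoint x by auto
    qed
    have w_cont: "continuous_on (unit_ball n) (\<lambda>x. w x i)" for i
      unfolding w_def
      by (intro continuous_on_diff continuous_on_product_then_coordinatewise[OF continuous_on_id]
          continuous_on_product_then_coordinatewise[OF f(1)])
    have w_Rn: "w x \<in> Rn n" if "x \<in> unit_ball n" for x
      using that f(2) by (auto simp: w_def Rn_def unit_ball_def)
    have "0 \<le> (\<Sum>i<n. normalize_vec n (w x) i * x i)" if "x \<in> unit_sphere n" for x
      unfolding w_def using that f(2) unit_sphere_subset_ball
      by (intro sum_normalize_diff_mult_nonneg) auto
    moreover have "(\<lambda>x. normalize_vec n (w x)) \<in> unit_ball n \<rightarrow> unit_sphere n"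
      using normalize_vec_in_unit_sphere[OF w_Rn w_nonzero] by blast
    ultimately show False
      using no_nonantipodal_map_ball_to_sphere[of m, folded Suc]
        continuous_on_normalize_vec[OF w_cont w_nonzero] by blast
  qed
qed

theorem brouwer_compact_convex:
  assumes K: "compact K" "convex_fun K" "K \<noteq> {}" "K \<subseteq> Rn n"
    and f: "continuous_on K f" "f \<in> K \<rightarrow> K"
  shows "\<exists>x\<in>K. f x = x"
proof -
  have "continuous_on K (sqnorm n)"
    by (intro continuous_intros continuous_on_product_then_coordinatewise continuous_on_id)
  then obtain x0 where "\<forall>x\<in>K. sqnorm n x \<le> sqnorm n x0"
    using continuous_attains_sup[OF K(1,3)] by blast
  then obtain R :: real where R: "R > 0" "\<And>x. x \<in> K \<Longrightarrow> sqnorm n x \<le> R\<^sup>2"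
    using sqnorm_nonneg[of n x0] by (intro that[of "sqrt (sqnorm n x0 + 1)"]) auto
  define shrink where "shrink x = (\<lambda>i. x i / R)" for x :: "nat \<Rightarrow> real"
  define expand where "expand x = (\<lambda>i. R * x i)" for x :: "nat \<Rightarrow> real"
  show ?thesis
  proof (rule invertible_fixpoint_property[where S = "unit_ball n" and i = shrink
        and r = "closest_pt n K \<circ> expand"])
    show "continuous_on K shrink"
      unfolding shrink_def
      by (intro continuous_on_coordinatewise_then_product continuous_on_divide continuous_on_const
          continuous_on_product_then_coordinatewise[OF continuous_on_id]) (use R in auto)
    show "shrink \<in> K \<rightarrow> unit_ball n"
    proof
      fix x assume x: "x \<in> K"
      have "sqnorm n (shrink x) = sqnorm n x / R\<^sup>2"
        by (simp add: shrink_def sqnorm_def power_divide sum_divide_distrib)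
      also have "\<dots> \<le> 1"
        using R x by simp
      finally show "shrink x \<in> unit_ball n"
        using x K(4) by (auto simp: unit_ball_def shrink_def Rn_def)
    qed
    have expand_cont: "continuous_on UNIV expand"
      unfolding expand_def
      by (intro continuous_on_coordinatewise_then_product continuous_on_mult continuous_on_const
          continuous_on_product_then_coordinatewise[OF continuous_on_id])
    show "continuous_on (unit_ball n) (closest_pt n K \<circ> expand)"
      by (rule continuous_on_subset[OF continuous_on_compose[OF expand_cont
            continuous_on_subset[OF continuous_closest_pt[OF K(1,3,2,4)]]]]) auto
    show "closest_pt n K \<circ> expand \<in> unit_ball n \<rightarrow> K"
      using closest_pt_in[OF K(1,3)] by auto
    show "(closest_pt n K \<circ> expand) (shrink y) = y" if "y \<in> K" for y
      using closest_pt_id[OF K(1,4) that] R by (simp add: expand_def shrink_def)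
  qed (use brouwer_unit_ball f in auto)
qed

definition flatten :: "nat \<Rightarrow> (nat \<Rightarrow> nat \<Rightarrow> real) \<Rightarrow> (nat \<Rightarrow> real)" where
  "flatten M y = (\<lambda>k. y (k div M) (k mod M))"

definition unflatten :: "nat \<Rightarrow> (nat \<Rightarrow> real) \<Rightarrow> (nat \<Rightarrow> nat \<Rightarrow> real)" where
  "unflatten M v = (\<lambda>i j. if j < M then v (i * M + j) else 0)"

lemma blockprod_Rn_entry_eq_0:
  assumes "y \<in> blockprod {..N} (\<lambda>_. Rn M)" "N < i \<or> M \<le> j"
  shows "y i j = 0"
  using assms by (cases "i \<le> N") (auto simp: blockprod_def Rn_def zvec_def)

lemma unflatten_flatten:
  assumes "y \<in> blockprod {..N} (\<lambda>_. Rn M)"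
  shows "unflatten M (flatten M y) = y"
proof (intro ext)
  fix i j
  show "unflatten M (flatten M y) i j = y i j"
    using blockprod_Rn_entry_eq_0[OF assms, of i j] by (auto simp: unflatten_def flatten_def)
qed

lemma flatten_in_Rn:
  assumes "y \<in> blockprod {..N} (\<lambda>_. Rn M)"
  shows "flatten M y \<in> Rn (Suc N * M)"
proof -
  have "y (k div M) (k mod M) = 0" if "Suc N * M \<le> k" for k
  proof (cases "M = 0")
    case False
    then have "N < k div M"
      using div_le_mono[OF that, of M] by simp
    then show ?thesis using blockprod_Rn_entry_eq_0[OF assms] by blast
  qed (use blockprod_Rn_entry_eq_0[OF assms] in auto)
  then show ?thesis by (simp add: flatten_def Rn_def)
qed

lemma continuous_on_flatten: "continuous_on S (flatten M)"
  unfolding flatten_def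
  by (intro continuous_on_coordinatewise_then_product continuous_on_product_then_coordinatewise
      [OF continuous_on_product_then_coordinatewise[OF continuous_on_id]])

lemma continuous_on_unflatten: "continuous_on S (unflatten M)"
  unfolding unflatten_def
proof (intro continuous_on_coordinatewise_then_product)
  fix i j
  show "continuous_on S (\<lambda>v. if j < M then v (i * M + j) else 0)"
    by (cases "j < M") (simp_all add: continuous_on_product_then_coordinatewise[OF continuous_on_id])
qed

lemma convex_fun_flatten_image:
  assumes "convex_blocks Y"
  shows "convex_fun (flatten M ` Y)"
  unfolding convex_fun_def
proof (intro ballI allI impI)
  fix t :: real and a b
  assume "a \<in> flatten M ` Y" "b \<in> flatten M ` Y" "0 \<le> t \<and> t \<le> 1"
  then obtain y y' where "y \<in> Y" "y' \<in> Y" "a = flatten M y" "b = flatten M y'" "0 \<le> t" "t \<le> 1"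
    by auto
  moreover have "(\<lambda>i j. (1 - t) * y i j + t * y' i j) \<in> Y"
    using assms calculation unfolding convex_blocks_def by blast
  ultimately show "(\<lambda>i. (1 - t) * a i + t * b i) \<in> flatten M ` Y"
    by (auto simp: flatten_def image_iff intro!: bexI[of _ "\<lambda>i j. (1 - t) * y i j + t * y' i j"])
qed

theorem brouwer_blocks:
  assumes Y: "compact Y" "convex_blocks Y" "Y \<noteq> {}" "Y \<subseteq> blockprod {..N} (\<lambda>_. Rn M)"
    and F: "continuous_on Y F" "F \<in> Y \<rightarrow> Y"
  shows "\<exists>y\<in>Y. F y = y"
proof (rule invertible_fixpoint_property[where S = "flatten M ` Y" and i = "flatten M"
      and r = "unflatten M"])
  show "\<And>g. continuous_on (flatten M ` Y) g \<Longrightarrow> g \<in> flatten M ` Y \<rightarrow> flatten M ` Y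
      \<Longrightarrow> \<exists>x\<in>flatten M ` Y. g x = x"
    using Y flatten_in_Rn
    by (intro brouwer_compact_convex[where n = "Suc N * M"] compact_continuous_image
        continuous_on_flatten convex_fun_flatten_image) auto
  show "unflatten M \<in> flatten M ` Y \<rightarrow> Y"
    using Y(4) unflatten_flatten by fastforce
  show "unflatten M (flatten M y) = y" if "y \<in> Y" for y
    using Y(4) unflatten_flatten that by blast
qed (use F continuous_on_flatten continuous_on_unflatten in auto)

section \<open>Reduction of (MDO) to (P)\<close>

lemma Rn_mono: "m \<le> n \<Longrightarrow> Rn m \<subseteq> Rn n"
  by (auto simp: Rn_def)

lemma blockprod_subset_blockprod_Rn:
  assumes "I \<subseteq> {..N}" "\<And>i. i \<in> I \<Longrightarrow> A i \<subseteq> Rn (d i)"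
  shows "blockprod I A \<subseteq> blockprod {..N} (\<lambda>_. Rn (\<Sum>i\<le>N. d i))"
proof
  fix y assume y: "y \<in> blockprod I A"
  have "y i \<in> Rn (\<Sum>i\<le>N. d i)" if "i \<le> N" for i
  proof (cases "i \<in> I")
    case True
    have "d i \<le> (\<Sum>i\<le>N. d i)"
      using that by (intro member_le_sum) auto
    then have "Rn (d i) \<subseteq> Rn (\<Sum>i\<le>N. d i)" by (rule Rn_mono)
    with y True assms(2) show ?thesis by (auto simp: blockprod_def)
  qed (use y in \<open>auto simp: blockprod_def Rn_def zvec_def\<close>)
  then show "y \<in> blockprod {..N} (\<lambda>_. Rn (\<Sum>i\<le>N. d i))"
    using y assms(1) by (auto simp: blockprod_def)
qed

lemma hmap_in_blockprod:
  assumes "\<And>i. i \<in> {1..N} \<Longrightarrow> h i (x 0) (x i) (ymin y i) \<in> Ys i"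
  shows "hmap N h x y \<in> blockprod {1..N} Ys"
  using assms by (simp add: hmap_def blockprod_def)

lemma coupling_iff_hmap_fixpoint:
  assumes "y \<in> blockprod {1..N} Ys"
  shows "(\<forall>i\<in>{1..N}. y i = h i (x 0) (x i) (ymin y i)) \<longleftrightarrow> y = hmap N h x y"
  using assms by (auto simp: hmap_def blockprod_def fun_eq_iff)

lemma feasMDO_iff:
  assumes L_fix: "\<And>x y. x \<in> X \<Longrightarrow> y \<in> blockprod {1..N} Ys \<Longrightarrow> y = hmap N h x y \<Longrightarrow> L x y = x"
  shows "feasMDO N q g0 g h L X (blockprod {1..N} Ys) x y \<longleftrightarrow>
    x \<in> X \<and> y \<in> blockprod {1..N} Ys \<and> y = hmap N h x y \<and> feasP N q g0 g x"
proof (cases "x \<in> X \<and> y \<in> blockprod {1..N} Ys")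
  case True
  then show ?thesis
    using coupling_iff_hmap_fixpoint[of y N Ys h x] L_fix[of x y] unfolding feasMDO_def by auto
qed (auto simp: feasMDO_def)

lemma solves_MDO_iff:
  fixes N :: nat and Ys :: "nat \<Rightarrow> (nat \<Rightarrow> real) set" and Y
  defines "Y \<equiv> blockprod {1..N} Ys"
  assumes L_fix: "\<And>x y. x \<in> X \<Longrightarrow> y \<in> Y \<Longrightarrow> y = hmap N h x y \<Longrightarrow> L x y = x"
    and fixpoint_exists: "\<And>x. x \<in> X \<Longrightarrow> \<exists>y\<in>Y. y = hmap N h x y"
    and x: "x \<in> X" and y: "y \<in> Y"
  shows "solves_MDO N q f g0 g h L X Y x y \<longleftrightarrow> y = hmap N h x y \<and> solves_P N q f g0 g X x"
proof -
  have feas: "feasMDO N q g0 g h L X Y x' y' \<longleftrightarrow>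
      x' \<in> X \<and> y' \<in> Y \<and> y' = hmap N h x' y' \<and> feasP N q g0 g x'" for x' y'
    unfolding Y_def by (rule feasMDO_iff) (use L_fix Y_def in blast)
  have min_iff: "(\<forall>x' y'. feasMDO N q g0 g h L X Y x' y' \<longrightarrow> c \<le> f (L x' y')) \<longleftrightarrow>
      (\<forall>x'\<in>X. feasP N q g0 g x' \<longrightarrow> c \<le> f x')" for c
  proof
    assume min_MDO: "\<forall>x' y'. feasMDO N q g0 g h L X Y x' y' \<longrightarrow> c \<le> f (L x' y')"
    show "\<forall>x'\<in>X. feasP N q g0 g x' \<longrightarrow> c \<le> f x'"
    proof (intro ballI impI)
      fix x' assume x': "x' \<in> X" "feasP N q g0 g x'"
      then obtain y' where y': "y' \<in> Y" "y' = hmap N h x' y'"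
        using fixpoint_exists by blast
      then have "feasMDO N q g0 g h L X Y x' y'" "L x' y' = x'"
        using feas x' L_fix by auto
      then show "c \<le> f x'" using min_MDO by metis
    qed
  next
    assume "\<forall>x'\<in>X. feasP N q g0 g x' \<longrightarrow> c \<le> f x'"
    then show "\<forall>x' y'. feasMDO N q g0 g h L X Y x' y' \<longrightarrow> c \<le> f (L x' y')"
      using feas L_fix by auto
  qed
  show ?thesis
  proof (cases "y = hmap N h x y")
    case True
    then have "L x y = x" using L_fix x y by blast
    then show ?thesis
      using min_iff feas x y True unfolding solves_MDO_def solves_P_def by simp
  qed (simp add: solves_MDO_def feas)
qed

lemma hmap_fixpoint_exists:
  fixes N :: nat and Ys :: "nat \<Rightarrow> (nat \<Rightarrow> real) set" and Y
  defines "Y \<equiv> blockprod {1..N} Ys"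
  assumes Y: "compact Y" "convex_blocks Y" "Y \<noteq> {}"
    and Ys: "\<And>i. i \<in> {1..N} \<Longrightarrow> Ys i \<subseteq> Rn (pp i)"
    and h: "continuous_on Y (hmap N h x)"
      "\<And>y i. y \<in> Y \<Longrightarrow> i \<in> {1..N} \<Longrightarrow> h i (x 0) (x i) (ymin y i) \<in> Ys i"
  shows "\<exists>y\<in>Y. y = hmap N h x y"
proof -
  have "Y \<subseteq> blockprod {..N} (\<lambda>_. Rn (\<Sum>i\<le>N. pp i))"
    unfolding Y_def by (rule blockprod_subset_blockprod_Rn) (use Ys in auto)
  moreover have "hmap N h x \<in> Y \<rightarrow> Y"
  proof
    fix y assume "y \<in> Y"
    then show "hmap N h x y \<in> Y"
      unfolding Y_def by (intro hmap_in_blockprod h(2)) (simp_all add: Y_def)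
  qed
  ultimately show ?thesis
    using brouwer_blocks[OF Y] h(1) by metis
qed

theorem proposition2:
  fixes N :: nat and dd pp q :: "nat \<Rightarrow> nat"
    and Xs Ys :: "nat \<Rightarrow> (nat \<Rightarrow> real) set"
    and f :: "(nat \<Rightarrow> nat \<Rightarrow> real) \<Rightarrow> real"
    and g0 :: "(nat \<Rightarrow> nat \<Rightarrow> real) \<Rightarrow> (nat \<Rightarrow> real)"
    and g :: "nat \<Rightarrow> (nat \<Rightarrow> real) \<Rightarrow> (nat \<Rightarrow> real) \<Rightarrow> (nat \<Rightarrow> real)"
    and h :: "nat \<Rightarrow> (nat \<Rightarrow> real) \<Rightarrow> (nat \<Rightarrow> real) \<Rightarrow> (nat \<Rightarrow> nat \<Rightarrow> real) \<Rightarrow> (nat \<Rightarrow> real)"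
    and L :: "(nat \<Rightarrow> nat \<Rightarrow> real) \<Rightarrow> (nat \<Rightarrow> nat \<Rightarrow> real) \<Rightarrow> (nat \<Rightarrow> nat \<Rightarrow> real)"
  defines "X \<equiv> blockprod {0..N} Xs"
    and "Y \<equiv> blockprod {1..N} Ys"
    and "S \<equiv> {(x, y). x \<in> blockprod {0..N} Xs \<and> y \<in> blockprod {1..N} Ys \<and> y = hmap N h x y}"
  assumes N: "N \<ge> 2"
    and dims: "\<forall>i\<in>{0..N}. dd i \<ge> 1" "\<forall>i\<in>{1..N}. pp i \<ge> 1" "\<forall>i\<in>{0..N}. q i \<ge> 1"
    and Xsub: "\<forall>i\<in>{0..N}. Xs i \<subseteq> Rn (dd i)"
    and Ysub: "\<forall>i\<in>{1..N}. Ys i \<subseteq> Rn (pp i)"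
    and Yconv: "convex_blocks Y"
    and Ycomp: "compact Y"
    and h_range: "\<forall>i\<in>{1..N}. \<forall>x\<in>X. \<forall>y\<in>Y. h i (x 0) (x i) (ymin y i) \<in> Ys i"
    and h_cont: "\<forall>x\<in>X. continuous_on Y (hmap N h x)"
    and L_range: "\<forall>x\<in>X. \<forall>y\<in>Y. L x y \<in> blockprod {0..N} (\<lambda>i. Rn (dd i))"
    and L_S: "\<forall>(x, y)\<in>S. L x y = x"
  shows "\<forall>x\<in>X. \<forall>y\<in>Y.
           solves_MDO N q f g0 g h L X Y x y \<longleftrightarrow> (x, y) \<in> S \<and> solves_P N q f g0 g X x"
proof (intro ballI)
  fix x y assume x: "x \<in> X" and y: "y \<in> Y"
  have L_fix: "L x' y' = x'" if "x' \<in> X" "y' \<in> Y" "y' = hmap N h x' y'" for x' y'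
    using L_S that by (auto simp: S_def X_def Y_def)
  have fixpoint: "\<exists>y'\<in>Y. y' = hmap N h x' y'" if x': "x' \<in> X" for x'
    unfolding Y_def
    by (rule hmap_fixpoint_exists) (use Ycomp Yconv y Ysub h_cont x' h_range in \<open>auto simp: Y_def\<close>)
  have "(x, y) \<in> S \<longleftrightarrow> y = hmap N h x y"
    using x y unfolding S_def X_def Y_def by blast
  then show "solves_MDO N q f g0 g h L X Y x y \<longleftrightarrow> (x, y) \<in> S \<and> solves_P N q f g0 g X x"
    using solves_MDO_iff[where N = N and Ys = Ys and X = X and h = h and L = L, folded Y_def,
        OF L_fix fixpoint x y] by blast
qed

end
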